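(* Let $(A,\circ,\alpha)$ be a multiplicative Hom-Jordan superalgebra, and write $xy:=x\circ y$. Define the ternary operation $$\langle x,y,z\rangle:=(xy)\alpha(z)+\alpha(x)(yz)-(-1)^{\bar x\bar y}\alpha(y)(xz)$$ for all homogeneous $x,y,z\in A$. Then $(A,\langle\cdot,\cdot,\cdot\rangle,\alpha^2)$ is a multiplicative Hom-Jordan supertriple system.
   Context: All vector spaces are over a fixed field of characteristic not $2$ or $3$. A superspace is a $\mathbb Z_2$-graded vector space $A=A_0\oplus A_1$; $\bar x$ is the degree of a homogeneous $x$. A linear map is even if it preserves degrees. A multiplicative Hom-superalgebra $(A,\circ,\alpha)$ is a superspace with a bilinear product satisfying $A_i\circ A_j\subseteq A_{i+j}$ and an even linear map $\alpha:A\to A$ with $\alpha(x\circ y)=\alpha(x)\circ\alpha(y)$. It is a Hom-Jordan superalgebra if $x\circ y=(-1)^{\bar x\bar y}y\circ x$ and $\circlearrowleft_{x,y,t}(-1)^{\bar t(\bar x+\bar z)}as(x\circ y,\alpha(z),\alpha(t))=0$ for all homogeneous $x,y,z,t$, where $as(a,b,c)=(a\circ b)\circ\alpha(c)-\alpha(a)\circ(b\circ c)$ and $\circlearrowleft_{x,y,t}$ is the sum over cyclic permutations of $x,y,t$. A multiplicative Hom-Jordan supertriple system $(V,\langle\cdot,\cdot,\cdot\rangle,\theta)$ is a superspace $V$ with a trilinear operation satisfying $\langle V_i,V_j,V_k\rangle\subseteq V_{i+j+k}$ and an even linear map $\theta:V\to V$ with $\theta(\langle x,y,z\rangle)=\langle\theta(x),\theta(y),\theta(z)\rangle$,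 such that for all homogeneous $u,v,w,x,y,z$: $\langle x,y,z\rangle=(-1)^{\bar x\bar y+\bar x\bar z+\bar y\bar z}\langle z,y,x\rangle$, and $\langle\theta(x),\theta(y),\langle u,v,w\rangle\rangle-\langle\langle x,y,u\rangle,\theta(v),\theta(w)\rangle=(-1)^{(\bar x+\bar y)(\bar u+\bar v)}\big(\langle\theta(u),\theta(v),\langle x,y,w\rangle\rangle-\langle\theta(u),\langle v,x,y\rangle,\theta(w)\rangle\big)$. *)

theory Defs
  imports Complex_Main "HOL-Library.Z2"
begin

text \<open>
  Superspaces are vector spaces (the whole type \<open>'a\<close>, with scalar multiplication \<open>scale\<close>) together
  with a family \<open>G\<close> of subspaces indexed by the two-element field \<^typ>\<open>bit\<close>; addition and
  multiplication of degrees are those of \<^typ>\<open>bit\<close>. "For all homogeneous \<open>x\<close>" is rendered as "for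
  all \<open>i\<close> and all \<open>x \<in> G i\<close>", with \<open>i\<close> in the role of the degree of \<open>x\<close>. The vector \<open>0\<close> thus has both
  degrees, which is harmless since all identities are multilinear.
\<close>

locale superspace = vector_space scale
  for scale :: "'k::field \<Rightarrow> 'a::ab_group_add \<Rightarrow> 'a" +
  fixes G :: "bit \<Rightarrow> 'a set"
  assumes subspace_G: "subspace (G i)"
    and G_inter: "G 0 \<inter> G 1 = {0}"
    and G_sum: "\<exists>y\<in>G 0. \<exists>z\<in>G 1. x = y + z"

text \<open>The projection onto the \<open>i\<close>-th summand; \<open>i + 1\<close> is the other degree.\<close>

definition component :: "(bit \<Rightarrow> 'a::ab_group_add set) \<Rightarrow> bit \<Rightarrow> 'a \<Rightarrow> 'a" where
  "component G i x = (THE y. y \<in> G i \<and> x - y \<in> G (i + 1))"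

definition even_map :: "(bit \<Rightarrow> 'a set) \<Rightarrow> ('a \<Rightarrow> 'a) \<Rightarrow> bool" where
  "even_map G f \<longleftrightarrow> (\<forall>i. \<forall>x\<in>G i. f x \<in> G i)"

definition bilinear_map ::
  "('k::field \<Rightarrow> 'a::ab_group_add \<Rightarrow> 'a) \<Rightarrow> ('a \<Rightarrow> 'a \<Rightarrow> 'a) \<Rightarrow> bool" where
  "bilinear_map scale f \<longleftrightarrow>
     (\<forall>y. Vector_Spaces.linear scale scale (\<lambda>x. f x y)) \<and>
     (\<forall>x. Vector_Spaces.linear scale scale (\<lambda>y. f x y))"

definition trilinear_map ::
  "('k::field \<Rightarrow> 'a::ab_group_add \<Rightarrow> 'a) \<Rightarrow> ('a \<Rightarrow> 'a \<Rightarrow> 'a \<Rightarrow> 'a) \<Rightarrow> bool" where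
  "trilinear_map scale f \<longleftrightarrow>
     (\<forall>y z. Vector_Spaces.linear scale scale (\<lambda>x. f x y z)) \<and>
     (\<forall>x z. Vector_Spaces.linear scale scale (\<lambda>y. f x y z)) \<and>
     (\<forall>x y. Vector_Spaces.linear scale scale (\<lambda>z. f x y z))"

text \<open>The scalar $(-1)^d$ for an exponent \<open>d\<close> in $Z_2$.\<close>

definition sign :: "bit \<Rightarrow> 'k::field" where
  "sign d = (if d = 0 then 1 else - 1)"

locale multiplicative_hom_superalgebra = superspace scale G
  for scale :: "'k::field \<Rightarrow> 'a::ab_group_add \<Rightarrow> 'a" and G +
  fixes mult :: "'a \<Rightarrow> 'a \<Rightarrow> 'a"  (infixl \<open>\<bullet>\<close> 70)
    and \<alpha> :: "'a \<Rightarrow> 'a"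
  assumes bilinear_mult: "bilinear_map scale mult"
    and mult_degree: "\<lbrakk>x \<in> G i; y \<in> G j\<rbrakk> \<Longrightarrow> x \<bullet> y \<in> G (i + j)"
    and linear_alpha: "Vector_Spaces.linear scale scale \<alpha>"
    and even_alpha: "even_map G \<alpha>"
    and alpha_mult: "\<alpha> (x \<bullet> y) = \<alpha> x \<bullet> \<alpha> y"
begin

definition hom_associator :: "'a \<Rightarrow> 'a \<Rightarrow> 'a \<Rightarrow> 'a" where
  "hom_associator a b c = (a \<bullet> b) \<bullet> \<alpha> c - \<alpha> a \<bullet> (b \<bullet> c)"

text \<open>
  The formula for the product of homogeneous \<open>x\<close> and \<open>y\<close>, of degrees \<open>i\<close> and \<open>j\<close>, with \<open>z\<close>, and its
  trilinear extension to all of \<open>'a\<close>. The degree of \<open>z\<close> does not occur in the formula, which is already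
  linear in \<open>z\<close>, so that only \<open>x\<close> and \<open>y\<close> have to be decomposed.
\<close>

definition homogeneous_triple :: "bit \<Rightarrow> bit \<Rightarrow> 'a \<Rightarrow> 'a \<Rightarrow> 'a \<Rightarrow> 'a" where
  "homogeneous_triple i j x y z =
     (x \<bullet> y) \<bullet> \<alpha> z + \<alpha> x \<bullet> (y \<bullet> z) - scale (sign (i * j)) (\<alpha> y \<bullet> (x \<bullet> z))"

definition triple :: "'a \<Rightarrow> 'a \<Rightarrow> 'a \<Rightarrow> 'a" where
  "triple x y z =
     (\<Sum>i\<in>{0, 1}. \<Sum>j\<in>{0, 1}. homogeneous_triple i j (component G i x) (component G j y) z)"

end

text \<open>
  In \<open>hom_jordan\<close> the three summands are the cyclic permutations of $x, y, t$ (together with their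
  degrees), with \<open>z\<close> kept fixed.
\<close>

locale multiplicative_hom_jordan_superalgebra = multiplicative_hom_superalgebra +
  assumes supercommutative:
    "\<lbrakk>x \<in> G i; y \<in> G j\<rbrakk> \<Longrightarrow> mult x y = scale (sign (i * j)) (mult y x)"
    and hom_jordan:
    "\<lbrakk>x \<in> G i; y \<in> G j; z \<in> G k; t \<in> G l\<rbrakk> \<Longrightarrow>
       scale (sign (l * (i + k))) (hom_associator (mult x y) (\<alpha> z) (\<alpha> t)) +
       scale (sign (i * (j + k))) (hom_associator (mult y t) (\<alpha> z) (\<alpha> x)) +
       scale (sign (j * (l + k))) (hom_associator (mult t x) (\<alpha> z) (\<alpha> y)) = 0"

locale multiplicative_hom_jordan_supertriple_system = superspace scale G
  for scale :: "'k::field \<Rightarrow> 'a::ab_group_add \<Rightarrow> 'a" and G +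
  fixes T :: "'a \<Rightarrow> 'a \<Rightarrow> 'a \<Rightarrow> 'a"
    and \<theta> :: "'a \<Rightarrow> 'a"
  assumes trilinear_T: "trilinear_map scale T"
    and T_degree: "\<lbrakk>x \<in> G i; y \<in> G j; z \<in> G k\<rbrakk> \<Longrightarrow> T x y z \<in> G (i + j + k)"
    and linear_theta: "Vector_Spaces.linear scale scale \<theta>"
    and even_theta: "even_map G \<theta>"
    and theta_T: "\<theta> (T x y z) = T (\<theta> x) (\<theta> y) (\<theta> z)"
    and T_symmetric: "\<lbrakk>x \<in> G i; y \<in> G j; z \<in> G k\<rbrakk> \<Longrightarrow>
       T x y z = scale (sign (i * j + i * k + j * k)) (T z y x)"
    and T_hom_jordan:
    "\<lbrakk>x \<in> G i; y \<in> G j; u \<in> G k; v \<in> G l; w \<in> G m\<rbrakk> \<Longrightarrow>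
       T (\<theta> x) (\<theta> y) (T u v w) - T (T x y u) (\<theta> v) (\<theta> w) =
       scale (sign ((i + j) * (k + l)))
         (T (\<theta> u) (\<theta> v) (T x y w) - T (\<theta> u) (T v x y) (\<theta> w))"

context superspace
begin

lemma component_homogeneous:
  assumes "x \<in> G i"
  shows "component G i x = x" and "component G (i + 1) x = 0"
proof -
  have inter: "y = 0" if "y \<in> G j" "y \<in> G (j + 1)" for y j
    using that G_inter by (cases j) auto
  have i2: "i + 1 + 1 = i" by (cases i) auto
  show "component G i x = x"
    unfolding component_def
  proof (rule the_equality)
    show "x \<in> G i \<and> x - x \<in> G (i + 1)"
      using assms subspace_0[OF subspace_G] by simp
    fix y assume "y \<in> G i \<and> x - y \<in> G (i + 1)"
    then have "x - y = 0" using inter[of "x - y" i] subspace_diff[OF subspace_G assms] by blast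
    then show "y = x" by simp
  qed
  show "component G (i + 1) x = 0"
    unfolding component_def i2
  proof (rule the_equality)
    show "0 \<in> G (i + 1) \<and> x - 0 \<in> G i"
      using assms subspace_0[OF subspace_G] by simp
    fix y assume y: "y \<in> G (i + 1) \<and> x - y \<in> G i"
    then have "x - (x - y) \<in> G i" using subspace_diff[OF subspace_G assms] by blast
    then show "y = 0" using inter[of y i] y by simp
  qed
qed

lemma component_sum:
  shows "component G i x \<in> G i" and "component G 0 x + component G 1 x = x"
proof -
  obtain y z where y: "y \<in> G 0" and z: "z \<in> G 1" and x: "x = y + z" using G_sum by blast
  have inter: "a = 0" if "a \<in> G 0" "a \<in> G 1" for a
    using that G_inter by blast
  have c0: "component G 0 x = y"
    unfolding component_def
  proof (rule the_equality)
    show "y \<in> G 0 \<and> x - y \<in> G (0 + 1)" using y z x by simp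
    fix a assume a: "a \<in> G 0 \<and> x - a \<in> G (0 + 1)"
    have "a - y \<in> G 0" using a y subspace_diff[OF subspace_G] by blast
    moreover have "z - (x - a) \<in> G 1" using a z subspace_diff[OF subspace_G] by simp
    ultimately show "a = y" using inter[of "a - y"] x by simp
  qed
  have c1: "component G 1 x = z"
    unfolding component_def
  proof (rule the_equality)
    show "z \<in> G 1 \<and> x - z \<in> G (1 + 1)" using y z x by simp
    fix a assume a: "a \<in> G 1 \<and> x - a \<in> G (1 + 1)"
    have "a - z \<in> G 1" using a z subspace_diff[OF subspace_G] by blast
    moreover have "y - (x - a) \<in> G 0" using a y subspace_diff[OF subspace_G] by simp
    ultimately show "a = z" using inter[of "a - z"] x by simp
  qed
  show "component G i x \<in> G i" using c0 c1 y z by (cases i) auto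
  show "component G 0 x + component G 1 x = x" using c0 c1 x by simp
qed

end

context multiplicative_hom_superalgebra
begin

lemma triple_homogeneous:
  assumes "x \<in> G i" "y \<in> G j"
  shows "triple x y z =
    (x \<bullet> y) \<bullet> \<alpha> z + \<alpha> x \<bullet> (y \<bullet> z) - scale (sign (i * j)) (\<alpha> y \<bullet> (x \<bullet> z))"
proof -
  have l1: "Vector_Spaces.linear scale scale (\<lambda>x. x \<bullet> y)" for y
    using bilinear_mult unfolding bilinear_map_def by blast
  have l2: "Vector_Spaces.linear scale scale (\<lambda>y. x \<bullet> y)" for x
    using bilinear_mult unfolding bilinear_map_def by blast
  interpret p: vector_space_pair scale scale by unfold_locales
  have z: "0 \<bullet> a = 0" "a \<bullet> 0 = 0" "\<alpha> 0 = 0" for a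
    using p.linear_0[OF l1[of a]] p.linear_0[OF l2[of a]] p.linear_0[OF linear_alpha] by auto
  have h: "homogeneous_triple k l 0 b c = 0" "homogeneous_triple k l a 0 c = 0" for a b c k l
    unfolding homogeneous_triple_def by (simp_all add: z)
  note cx = component_homogeneous[OF assms(1)] and cy = component_homogeneous[OF assms(2)]
  have "triple x y z = homogeneous_triple i j x y z"
    unfolding triple_def using cx cy by (cases i; cases j) (simp_all add: h)
  then show ?thesis by (simp add: homogeneous_triple_def)
qed

lemma triple_unique:
  assumes T: "trilinear_map scale T"
    and hom: "\<And>i j k x y z. \<lbrakk>x \<in> G i; y \<in> G j; z \<in> G k\<rbrakk> \<Longrightarrow>
      T x y z = (x \<bullet> y) \<bullet> \<alpha> z + \<alpha> x \<bullet> (y \<bullet> z) - scale (sign (i * j)) (\<alpha> y \<bullet> (x \<bullet> z))"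
  shows "T = triple"
proof (intro ext)
  fix x y z
  interpret p: vector_space_pair scale scale by unfold_locales
  have l1: "Vector_Spaces.linear scale scale (\<lambda>x. x \<bullet> y)" for y
    using bilinear_mult unfolding bilinear_map_def by blast
  have l2: "Vector_Spaces.linear scale scale (\<lambda>y. x \<bullet> y)" for x
    using bilinear_mult unfolding bilinear_map_def by blast
  have t1: "T (a + b) c d = T a c d + T b c d"
    and t2: "T c (a + b) d = T c a d + T c b d"
    and t3: "T c d (a + b) = T c d a + T c d b" for a b c d
    using T unfolding trilinear_map_def by (blast dest: p.linear_add)+
  have m: "a \<bullet> (b + c) = a \<bullet> b + a \<bullet> c" "\<alpha> (b + c) = \<alpha> b + \<alpha> c" for a b c
    using p.linear_add[OF l2] p.linear_add[OF linear_alpha] by auto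
  have h3: "homogeneous_triple i j a b (c + d) =
      homogeneous_triple i j a b c + homogeneous_triple i j a b d" for i j a b c d
    unfolding homogeneous_triple_def by (simp add: m scale_right_distrib algebra_simps)
  have Th: "T a b c = homogeneous_triple i j a b c" if "a \<in> G i" "b \<in> G j" for a b c i j
  proof -
    have "T a b c = T a b (component G 0 c + component G 1 c)" by (simp add: component_sum)
    also have "\<dots> = homogeneous_triple i j a b (component G 0 c + component G 1 c)"
      unfolding t3 h3
      using hom[OF that component_sum(1)[of 0 c]] hom[OF that component_sum(1)[of 1 c]]
      by (simp add: homogeneous_triple_def)
    finally show ?thesis by (simp add: component_sum)
  qed
  have "T x y z = T (component G 0 x + component G 1 x) (component G 0 y + component G 1 y) z"
    by (simp add: component_sum)
  also have "\<dots> = triple x y z"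
    unfolding triple_def t1 t2 by (simp add: Th[OF component_sum(1) component_sum(1)])
  finally show "T x y z = triple x y z" .
qed

end

end

theory Submission
  imports Defs
begin

text \<open>
  Write \<open>D\<^bsub>x,y\<^esub> z = \<alpha>(x)(yz) - (-1)\<^bsup>xy\<^esup> \<alpha>(y)(xz)\<close> (\<open>inner_derivation\<close>), the Hom-version of
  \<open>[L\<^sub>x, L\<^sub>y] z\<close>, so that \<open>\<langle>x, y, z\<rangle> = (xy)\<alpha>(z) + D\<^bsub>x,y\<^esub> z\<close>. In the Hom-Jordan identity the terms
  \<open>\<alpha>(xy)(\<alpha>(z)\<alpha>(t))\<close> add up to an expression that is supersymmetric in all four variables; comparing
  the instances with \<open>z\<close> and with one of the other variables in the middle shows that \<open>D\<close> is a twisted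
  superderivation of the product, hence of \<open>\<langle>\<cdot>, \<cdot>, \<cdot>\<rangle>\<close>. Together with the Hom-Jordan identity itself this
  also gives the rule \<open>[L\<^sub>a, T\<^bsub>u,v\<^esub>] = T\<^bsub>au,v\<^esub> - T\<^bsub>u,av\<^esub>\<close> (up to signs and twists by \<open>\<alpha>\<close>) for \<open>L\<^sub>a\<close> the
  multiplication by \<open>a\<close> and \<open>T\<^bsub>u,v\<^esub> = \<langle>u, v, \<cdot>\<rangle>\<close>. The five-variable identity is the sum of the rule for
  \<open>D\<^bsub>x,y\<^esub>\<close> and the rule for \<open>L\<^bsub>xy\<^esub>\<close>.
\<close>

section \<open>Linearity of the projections onto the homogeneous components\<close>

context superspace
begin

lemma linearI:
  assumes "\<And>x y. f (x + y) = f x + f y" "\<And>c x. f (scale c x) = scale c (f x)"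
  shows "Vector_Spaces.linear scale scale f"
  unfolding Vector_Spaces.linear_iff using assms vector_space_axioms by blast

text \<open>Two candidates for the component differ by a vector of both degrees, hence by 0. This
  reduces the linearity of the projections to membership checks.\<close>

lemma component_eqI:
  assumes "y \<in> G i" "x - y \<in> G (i + 1)"
  shows "component G i x = y"
proof -
  have "z = y" if z: "z \<in> G i \<and> x - z \<in> G (i + 1)" for z
  proof -
    have "z - y \<in> G i" using z assms subspace_diff[OF subspace_G] by blast
    moreover have "(x - y) - (x - z) \<in> G (i + 1)"
      using z assms subspace_diff[OF subspace_G] by blast
    ultimately have "z - y \<in> G 0 \<inter> G 1" by (cases i) auto
    then show ?thesis using G_inter by simp
  qed
  then show ?thesis unfolding component_def using assms by blast
qed

lemma component_diff: "x - component G i x \<in> G (i + 1)"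
proof (cases i)
  case zero
  have "x - component G 0 x = component G 1 x" using component_sum(2)[of x]
    by (simp add: diff_eq_eq add.commute)
  then show ?thesis using component_sum(1)[of 1 x] zero by simp
next
  case one
  have "x - component G 1 x = component G 0 x" using component_sum(2)[of x]
    by (simp add: diff_eq_eq)
  then show ?thesis using component_sum(1)[of 0 x] one by simp
qed

lemma component_add: "component G i (x + y) = component G i x + component G i y"
proof (rule component_eqI)
  show "component G i x + component G i y \<in> G i"
    by (intro subspace_add[OF subspace_G] component_sum(1))
  have "(x - component G i x) + (y - component G i y) \<in> G (i + 1)"
    by (intro subspace_add[OF subspace_G] component_diff)
  then show "x + y - (component G i x + component G i y) \<in> G (i + 1)"
    by (simp add: algebra_simps)
qed

lemma component_scale: "component G i (scale c x) = scale c (component G i x)"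
proof (rule component_eqI)
  show "scale c (component G i x) \<in> G i"
    by (intro subspace_scale[OF subspace_G] component_sum(1))
  have "scale c (x - component G i x) \<in> G (i + 1)"
    by (intro subspace_scale[OF subspace_G] component_diff)
  then show "scale c x - scale c (component G i x) \<in> G (i + 1)"
    by (simp add: scale_right_diff_distrib)
qed

lemma component_even_linear:
  assumes "even_map G f" "Vector_Spaces.linear scale scale f"
  shows "component G i (f x) = f (component G i x)"
proof (rule component_eqI)
  interpret p: vector_space_pair scale scale by unfold_locales
  show "f (component G i x) \<in> G i"
    using assms component_sum(1) unfolding even_map_def by blast
  show "f x - f (component G i x) \<in> G (i + 1)"
    using assms(1) component_diff[of x i] p.linear_diff[OF assms(2)]
    unfolding even_map_def by metis
qed

end

section \<open>Linearity, twist and degree of the triple product and of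
  \<open>inner_derivation\<close>\<close>

context multiplicative_hom_superalgebra
begin

lemma mult_linear:
  shows "(a + b) \<bullet> c = a \<bullet> c + b \<bullet> c" "c \<bullet> (a + b) = c \<bullet> a + c \<bullet> b"
    and "(a - b) \<bullet> c = a \<bullet> c - b \<bullet> c" "c \<bullet> (a - b) = c \<bullet> a - c \<bullet> b"
    and "(- a) \<bullet> c = - (a \<bullet> c)" "c \<bullet> (- a) = - (c \<bullet> a)"
    and "scale r a \<bullet> c = scale r (a \<bullet> c)" "c \<bullet> scale r a = scale r (c \<bullet> a)"
proof -
  interpret p: vector_space_pair scale scale by unfold_locales
  have l: "Vector_Spaces.linear scale scale (\<lambda>x. x \<bullet> c)"
    and r: "Vector_Spaces.linear scale scale (\<lambda>y. c \<bullet> y)"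
    using bilinear_mult unfolding bilinear_map_def by blast+
  show "(a + b) \<bullet> c = a \<bullet> c + b \<bullet> c" "(a - b) \<bullet> c = a \<bullet> c - b \<bullet> c"
    "(- a) \<bullet> c = - (a \<bullet> c)" "scale r a \<bullet> c = scale r (a \<bullet> c)"
    using p.linear_add[OF l] p.linear_diff[OF l] p.linear_neg[OF l] p.linear_scale[OF l] by auto
  show "c \<bullet> (a + b) = c \<bullet> a + c \<bullet> b" "c \<bullet> (a - b) = c \<bullet> a - c \<bullet> b"
    "c \<bullet> (- a) = - (c \<bullet> a)" "c \<bullet> scale r a = scale r (c \<bullet> a)"
    using p.linear_add[OF r] p.linear_diff[OF r] p.linear_neg[OF r] p.linear_scale[OF r] by auto
qed

lemma alpha_linear:
  "\<alpha> (a + b) = \<alpha> a + \<alpha> b" "\<alpha> (a - b) = \<alpha> a - \<alpha> b" "\<alpha> (- a) = - \<alpha> a"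
  "\<alpha> (scale r a) = scale r (\<alpha> a)"
proof -
  interpret p: vector_space_pair scale scale by unfold_locales
  show "\<alpha> (a + b) = \<alpha> a + \<alpha> b" "\<alpha> (a - b) = \<alpha> a - \<alpha> b" "\<alpha> (- a) = - \<alpha> a"
    "\<alpha> (scale r a) = scale r (\<alpha> a)"
    using p.linear_add[OF linear_alpha] p.linear_diff[OF linear_alpha]
      p.linear_neg[OF linear_alpha] p.linear_scale[OF linear_alpha] by auto
qed

lemma alpha_degree: "x \<in> G i \<Longrightarrow> \<alpha> x \<in> G i"
  using even_alpha unfolding even_map_def by blast

text \<open>The sign depends on the degrees of the first two arguments, so for arbitrary vectors
  linearity in them rests on the linearity of the projections.\<close>

lemma trilinear_triple: "trilinear_map scale triple"
  unfolding trilinear_map_def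
  by (intro conjI allI linearI)
    (simp_all add: triple_def homogeneous_triple_def component_add component_scale mult_linear
      alpha_linear algebra_simps mult.commute)

lemma triple_linear:
  shows "triple (a + b) c d = triple a c d + triple b c d"
    and "triple c (a + b) d = triple c a d + triple c b d"
    and "triple c (a - b) d = triple c a d - triple c b d"
    and "triple c d (a + b) = triple c d a + triple c d b"
    and "triple c (scale r a) d = scale r (triple c a d)"
proof -
  interpret p: vector_space_pair scale scale by unfold_locales
  have l: "Vector_Spaces.linear scale scale (\<lambda>x. triple x c d)"
    "Vector_Spaces.linear scale scale (\<lambda>y. triple c y d)"
    "Vector_Spaces.linear scale scale (\<lambda>z. triple c d z)" for c d
    using trilinear_triple unfolding trilinear_map_def by blast+
  show "triple (a + b) c d = triple a c d + triple b c d"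
    "triple c (a + b) d = triple c a d + triple c b d"
    "triple c (a - b) d = triple c a d - triple c b d"
    "triple c d (a + b) = triple c d a + triple c d b"
    "triple c (scale r a) d = scale r (triple c a d)"
    using p.linear_add[OF l(1)] p.linear_add[OF l(2)] p.linear_diff[OF l(2)] p.linear_add[OF l(3)]
      p.linear_scale[OF l(2)] by auto
qed

text \<open>Being even and linear, \<alpha> commutes with the projections, so no homogeneity has to
  be assumed.\<close>

lemma alpha_triple: "\<alpha> (triple x y z) = triple (\<alpha> x) (\<alpha> y) (\<alpha> z)"
  by (simp add: triple_def homogeneous_triple_def alpha_linear alpha_mult
      component_even_linear[OF even_alpha linear_alpha])

lemma triple_degree:
  assumes "x \<in> G i" "y \<in> G j" "z \<in> G k"
  shows "triple x y z \<in> G (i + j + k)"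
proof -
  have "(x \<bullet> y) \<bullet> \<alpha> z \<in> G (i + j + k)" "\<alpha> x \<bullet> (y \<bullet> z) \<in> G (i + (j + k))"
    "\<alpha> y \<bullet> (x \<bullet> z) \<in> G (j + (i + k))"
    by (intro mult_degree alpha_degree assms)+
  then show ?thesis unfolding triple_homogeneous[OF assms(1,2)]
    by (intro subspace_add[OF subspace_G] subspace_diff[OF subspace_G]
        subspace_scale[OF subspace_G]) (simp_all only: add.assoc add.left_commute)
qed

text \<open>Taking the degrees of \<open>x\<close> and \<open>y\<close> as arguments keeps the sign
  an explicit scalar and avoids projections.\<close>

definition inner_derivation :: "bit \<Rightarrow> bit \<Rightarrow> 'a \<Rightarrow> 'a \<Rightarrow> 'a \<Rightarrow> 'a" where
  "inner_derivation i j x y z = \<alpha> x \<bullet> (y \<bullet> z) - scale (sign (i * j)) (\<alpha> y \<bullet> (x \<bullet> z))"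

lemma triple_inner_derivation:
  assumes "x \<in> G i" "y \<in> G j"
  shows "triple x y z = (x \<bullet> y) \<bullet> \<alpha> z + inner_derivation i j x y z"
  by (simp add: triple_homogeneous[OF assms] inner_derivation_def)

lemma alpha_inner_derivation:
  "\<alpha> (inner_derivation i j x y z) = inner_derivation i j (\<alpha> x) (\<alpha> y) (\<alpha> z)"
  by (simp add: inner_derivation_def alpha_linear alpha_mult)

lemma inner_derivation_linear:
  "inner_derivation i j x y (a + b) = inner_derivation i j x y a + inner_derivation i j x y b"
  "inner_derivation i j x y (a - b) = inner_derivation i j x y a - inner_derivation i j x y b"
  "inner_derivation i j x y (scale r a) = scale r (inner_derivation i j x y a)"
  by (simp_all add: inner_derivation_def mult_linear algebra_simps mult.commute)

lemma inner_derivation_degree: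
  assumes "x \<in> G i" "y \<in> G j" "z \<in> G k"
  shows "inner_derivation i j x y z \<in> G (i + j + k)"
proof -
  have "\<alpha> x \<bullet> (y \<bullet> z) \<in> G (i + (j + k))" "\<alpha> y \<bullet> (x \<bullet> z) \<in> G (j + (i + k))"
    by (intro mult_degree alpha_degree assms)+
  then show ?thesis unfolding inner_derivation_def
    by (intro subspace_diff[OF subspace_G] subspace_scale[OF subspace_G])
      (simp_all only: add.assoc add.left_commute)
qed

end

section \<open>Consequences of supercommutativity and the Hom-Jordan identity\<close>

context multiplicative_hom_jordan_superalgebra
begin

text \<open>After a case distinction on the degrees, these rules leave identities in the additive
  group only.\<close>

lemma signs: "scale (sign 0) x = x" "scale (sign 1) x = - x"
  by (simp_all add: sign_def)

text \<open>Each of the three values of \<open>inner_derivation\<close> is a difference of two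
  nested products. The Hom-Jordan identity with \<open>x\<close> in the middle accounts for one of
  the two in every case, the one with \<open>y\<close> in the middle for the other.\<close>

lemma inner_derivation_mult:
  assumes h: "x \<in> G i" "y \<in> G j" "z \<in> G k" "w \<in> G l"
  shows "inner_derivation i j (\<alpha> x) (\<alpha> y) (z \<bullet> w) =
    inner_derivation i j x y z \<bullet> \<alpha> (\<alpha> w) +
    scale (sign ((i + j) * k)) (\<alpha> (\<alpha> z) \<bullet> inner_derivation i j x y w)"
proof -
  note c2 = supercommutative
  have c3: "(a \<bullet> b) \<bullet> c = scale (sign (p * q + (p + q) * r)) (c \<bullet> (b \<bullet> a))"
    if "a \<in> G p" "b \<in> G q" "c \<in> G r" for a b c p q r
    using c2[OF that(1,2)] c2[OF mult_degree[OF that(2,1)] that(3)]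
    by (cases p; cases q; cases r; simp add: signs mult_linear)
  have c4: "(a \<bullet> b) \<bullet> (c \<bullet> d) = scale (sign ((p + q) * (r + s) + r * s)) ((d \<bullet> c) \<bullet> (a \<bullet> b))"
    if "a \<in> G p" "b \<in> G q" "c \<in> G r" "d \<in> G s" for a b c d p q r s
    unfolding c2[OF mult_degree[OF that(1,2)] mult_degree[OF that(3,4)]]
    unfolding c2[OF that(3,4)] by (cases p; cases q; cases r; cases s; simp add: signs mult_linear)
  note X = h(1)[THEN alpha_degree] and Y = h(2)[THEN alpha_degree]
    and Z = h(3)[THEN alpha_degree] and W = h(4)[THEN alpha_degree]
  \<comment> \<open>Supercommutativity, oriented so that the nested products of the Hom-Jordan
    identities become those occurring in the claim.\<close>
  have r: "((z \<bullet> y) \<bullet> \<alpha> x) = scale (sign (k * j + (k + j) * i)) (\<alpha> x \<bullet> (y \<bullet> z))"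
    "((z \<bullet> x) \<bullet> \<alpha> y) = scale (sign (k * i + (k + i) * j)) (\<alpha> y \<bullet> (x \<bullet> z))"
    "((w \<bullet> z) \<bullet> \<alpha> y) = scale (sign (l * k + (l + k) * j)) (\<alpha> y \<bullet> (z \<bullet> w))"
    "((w \<bullet> z) \<bullet> \<alpha> x) = scale (sign (l * k + (l + k) * i)) (\<alpha> x \<bullet> (z \<bullet> w))"
    "((y \<bullet> w) \<bullet> \<alpha> x) = scale (sign ((j + l) * i)) (\<alpha> x \<bullet> (y \<bullet> w))"
    "((x \<bullet> w) \<bullet> \<alpha> y) = scale (sign ((i + l) * j)) (\<alpha> y \<bullet> (x \<bullet> w))"
    using c3[OF h(3,2) X] c3[OF h(3,1) Y] c3[OF h(4,3) Y] c3[OF h(4,3) X]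
     c2[OF mult_degree[OF h(2,4)] X] c2[OF mult_degree[OF h(1,4)] Y] by (simp_all only: )
  have r2: "(\<alpha> y \<bullet> (z \<bullet> w)) \<bullet> \<alpha> (\<alpha> x) = scale (sign ((j + k + l) * i)) (\<alpha> (\<alpha> x) \<bullet> (\<alpha> y \<bullet> (z \<bullet> w)))"
    "(\<alpha> x \<bullet> (z \<bullet> w)) \<bullet> \<alpha> (\<alpha> y) = scale (sign ((i + k + l) * j)) (\<alpha> (\<alpha> y) \<bullet> (\<alpha> x \<bullet> (z \<bullet> w)))"
    "(\<alpha> x \<bullet> (y \<bullet> w)) \<bullet> \<alpha> (\<alpha> z) = scale (sign ((i + j + l) * k)) (\<alpha> (\<alpha> z) \<bullet> (\<alpha> x \<bullet> (y \<bullet> w)))"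
    "(\<alpha> y \<bullet> (x \<bullet> w)) \<bullet> \<alpha> (\<alpha> z) = scale (sign ((i + j + l) * k)) (\<alpha> (\<alpha> z) \<bullet> (\<alpha> y \<bullet> (x \<bullet> w)))"
    using c2[OF mult_degree[OF Y mult_degree[OF h(3,4)]] X[THEN alpha_degree]]
     c2[OF mult_degree[OF X mult_degree[OF h(3,4)]] Y[THEN alpha_degree]]
     c2[OF mult_degree[OF X mult_degree[OF h(2,4)]] Z[THEN alpha_degree]]
     c2[OF mult_degree[OF Y mult_degree[OF h(1,4)]] Z[THEN alpha_degree]]
    by (simp_all only: ac_simps)
  have r4: "(\<alpha> y \<bullet> \<alpha> w) \<bullet> (\<alpha> x \<bullet> \<alpha> z) = scale (sign ((j + l) * (i + k) + i * k)) ((\<alpha> z \<bullet> \<alpha> x) \<bullet> (\<alpha> y \<bullet> \<alpha> w))"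
    "(\<alpha> x \<bullet> \<alpha> w) \<bullet> (\<alpha> y \<bullet> \<alpha> z) = scale (sign ((i + l) * (j + k) + j * k)) ((\<alpha> z \<bullet> \<alpha> y) \<bullet> (\<alpha> x \<bullet> \<alpha> w))"
    "\<alpha> y \<bullet> \<alpha> x = scale (sign (i * j)) (\<alpha> x \<bullet> \<alpha> y)"
    using c4[OF Y W X Z] c4[OF X W Y Z] c2[OF Y X] by (simp_all only: mult.commute[of j i])
  \<comment> \<open>The instances of the Hom-Jordan identity with \<open>x\<close> and with \<open>y\<close> in the middle; below, their terms
    with \<open>\<alpha> (z \<bullet> w)\<close> cancel and the other products of two pairs cancel crosswise.\<close>
  let ?J1 = "scale (sign (l * (k + i))) (hom_associator (z \<bullet> y) (\<alpha> x) (\<alpha> w)) +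
     scale (sign (k * (j + i))) (hom_associator (y \<bullet> w) (\<alpha> x) (\<alpha> z)) +
     scale (sign (j * (l + i))) (hom_associator (w \<bullet> z) (\<alpha> x) (\<alpha> y))"
  let ?J2 = "scale (sign (l * (k + j))) (hom_associator (z \<bullet> x) (\<alpha> y) (\<alpha> w)) +
     scale (sign (k * (i + j))) (hom_associator (x \<bullet> w) (\<alpha> y) (\<alpha> z)) +
     scale (sign (i * (l + j))) (hom_associator (w \<bullet> z) (\<alpha> y) (\<alpha> x))"
  \<comment> \<open>The signs before \<open>?J2\<close> and \<open>?J1\<close> are those that give
    \<open>\<alpha> (\<alpha> x) \<bullet> (\<alpha> y \<bullet> (z \<bullet> w))\<close> and
    \<open>\<alpha> (\<alpha> y) \<bullet> (\<alpha> x \<bullet> (z \<bullet> w))\<close> their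
    coefficients in the first term on the left.\<close>
  have "inner_derivation i j (\<alpha> x) (\<alpha> y) (z \<bullet> w) -
     (inner_derivation i j x y z \<bullet> \<alpha> (\<alpha> w) +
      scale (sign ((i + j) * k)) (\<alpha> (\<alpha> z) \<bullet> inner_derivation i j x y w)) =
     scale (sign (l * k + (k + l) * j + k * i)) ?J2 -
     scale (sign (l * k + (k + l) * i + k * j + i * j)) ?J1"
    by (simp only: hom_associator_def inner_derivation_def alpha_mult r r2 r4 mult_linear)
      (cases i; cases j; cases k; cases l; simp add: signs algebra_simps)
  then show ?thesis
    unfolding hom_jordan[OF h(3,2,1,4)] hom_jordan[OF h(3,1,2,4)] scale_zero_right diff_zero
    by (rule iffD2[OF eq_iff_diff_eq_0])
qed

text \<open>In contrast to a derivation, multiplication by \<open>a\<close> enters the middle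
  argument with a minus sign.\<close>

lemma mult_triple:
  assumes h: "a \<in> G i" "u \<in> G j" "v \<in> G k" "w \<in> G l"
  shows "\<alpha> (\<alpha> a) \<bullet> triple u v w =
    triple (a \<bullet> u) (\<alpha> v) (\<alpha> w) - scale (sign (i * j)) (triple (\<alpha> u) (a \<bullet> v) (\<alpha> w)) +
    scale (sign (i * (j + k))) (triple (\<alpha> u) (\<alpha> v) (a \<bullet> w))"
proof -
  note c = supercommutative
  note A = h(1)[THEN alpha_degree] and U = h(2)[THEN alpha_degree]
    and V = h(3)[THEN alpha_degree] and W = h(4)[THEN alpha_degree]
  note A2 = A[THEN alpha_degree] and U2 = U[THEN alpha_degree] and V2 = V[THEN alpha_degree]
  note AU = mult_degree[OF h(1,2)] and AV = mult_degree[OF h(1,3)] and UV = mult_degree[OF h(2,3)]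
  note r1 = c[OF h(3,1)] c[OF h(2,1)] c[OF AU V] c[OF W V] c[OF W A] c[OF W U] c[OF V A]
  note r2 = c[OF mult_degree[OF AU W] V2] c[OF mult_degree[OF UV W] A2]
    c[OF mult_degree[OF AV W] U2]
  note t = triple_homogeneous[OF h(2,3)] triple_homogeneous[OF AU V] triple_homogeneous[OF U AV]
    triple_homogeneous[OF U V]
  \<comment> \<open>\<open>?J\<close> is the Hom-Jordan identity with \<open>w\<close> in the
    middle, and \<open>?D\<close> is the defect in the derivation rule for
    \<open>a \<bullet> w\<close>. Up to signs, the expanded claim is their difference.\<close>
  let ?J = "scale (sign (k * (i + l))) (hom_associator (a \<bullet> u) (\<alpha> w) (\<alpha> v)) +
     scale (sign (i * (j + l))) (hom_associator (u \<bullet> v) (\<alpha> w) (\<alpha> a)) +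
     scale (sign (j * (k + l))) (hom_associator (v \<bullet> a) (\<alpha> w) (\<alpha> u))"
  let ?D = "inner_derivation j k (\<alpha> u) (\<alpha> v) (a \<bullet> w) - (inner_derivation j k u v a \<bullet> \<alpha> (\<alpha> w) +
    scale (sign ((j + k) * i)) (\<alpha> (\<alpha> a) \<bullet> inner_derivation j k u v w))"
  have "\<alpha> (\<alpha> a) \<bullet> triple u v w -
    (triple (a \<bullet> u) (\<alpha> v) (\<alpha> w) - scale (sign (i * j)) (triple (\<alpha> u) (a \<bullet> v) (\<alpha> w)) +
     scale (sign (i * (j + k))) (triple (\<alpha> u) (\<alpha> v) (a \<bullet> w))) =
    scale (sign (i * k)) ?J - scale (sign (i * (j + k))) ?D"
    by (simp only: hom_associator_def inner_derivation_def t alpha_mult r1 r2 mult_linear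
        alpha_linear)
      (cases i; cases j; cases k; cases l; simp add: signs algebra_simps)
  moreover have "?D = 0"
    using inner_derivation_mult[OF h(2,3,1,4)] by (simp only: diff_self)
  ultimately show ?thesis
    unfolding hom_jordan[OF h(1,2,4,3)] by (simp only: scale_zero_right diff_zero right_minus_eq)
qed

text \<open>The triple product is a combination of nested products, to which the derivation rule
  applies twice.\<close>

lemma inner_derivation_triple:
  assumes h: "x \<in> G i" "y \<in> G j" "u \<in> G k" "v \<in> G l" "w \<in> G m"
  shows "inner_derivation i j (\<alpha> (\<alpha> x)) (\<alpha> (\<alpha> y)) (triple u v w) =
    triple (inner_derivation i j x y u) (\<alpha> (\<alpha> v)) (\<alpha> (\<alpha> w)) +
    scale (sign ((i + j) * k)) (triple (\<alpha> (\<alpha> u)) (inner_derivation i j x y v) (\<alpha> (\<alpha> w))) +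
    scale (sign ((i + j) * (k + l))) (triple (\<alpha> (\<alpha> u)) (\<alpha> (\<alpha> v)) (inner_derivation i j x y w))"
proof -
  note d = inner_derivation_degree[OF h(1,2)]
  note X = h(1)[THEN alpha_degree] and Y = h(2)[THEN alpha_degree]
  note U = h(3)[THEN alpha_degree] and V = h(4)[THEN alpha_degree] and W = h(5)[THEN alpha_degree]
  note U2 = U[THEN alpha_degree] and V2 = V[THEN alpha_degree]
  note t = triple_homogeneous[OF h(3,4)] triple_homogeneous[OF d[OF h(3)] V2]
    triple_homogeneous[OF U2 d[OF h(4)]] triple_homogeneous[OF U2 V2]
  \<comment> \<open>The first three instances treat the outer products, the last three the inner
    ones. Each level removes one \<alpha> from \<open>x\<close> and \<open>y\<close>.\<close>
  note p = inner_derivation_mult[OF X Y mult_degree[OF h(3,4)] W]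
    inner_derivation_mult[OF X Y U mult_degree[OF h(4,5)]]
    inner_derivation_mult[OF X Y V mult_degree[OF h(3,5)]]
    inner_derivation_mult[OF h(1,2,3,4)] inner_derivation_mult[OF h(1,2,4,5)]
    inner_derivation_mult[OF h(1,2,3,5)]
  show ?thesis
    by (simp only: t inner_derivation_linear p alpha_inner_derivation[symmetric]
        alpha_mult mult_linear)
      (cases i; cases j; cases k; cases l; simp add: signs algebra_simps)
qed

text \<open>Up to signs, the outer two of the three summands form the commutator. Compared with
  \<open>triple x y v\<close>, it has the opposite sign.\<close>

lemma triple_rotate:
  assumes h: "x \<in> G i" "y \<in> G j" "v \<in> G k"
  shows "triple v x y = scale (sign ((i + j) * k)) ((x \<bullet> y) \<bullet> \<alpha> v - inner_derivation i j x y v)"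
proof -
  note c = supercommutative[OF h(3,1)] supercommutative[OF h(3,2)]
    supercommutative[OF alpha_degree[OF h(3)] mult_degree[OF h(1,2)]]
    supercommutative[OF mult_degree[OF h(1,3)] alpha_degree[OF h(2)]]
  show ?thesis
    by (simp only: triple_homogeneous[OF h(3,1)] inner_derivation_def c mult_linear)
      (cases i; cases j; cases k; simp add: signs algebra_simps)
qed

text \<open>Up to signs, exchanging \<open>x\<close> and \<open>z\<close> swaps the first two
  summands and fixes the third.\<close>

lemma triple_symmetric:
  assumes h: "x \<in> G i" "y \<in> G j" "z \<in> G k"
  shows "triple x y z = scale (sign (i * j + i * k + j * k)) (triple z y x)"
proof -
  note c = supercommutative[OF h(3,2)] supercommutative[OF h(2,1)] supercommutative[OF h(3,1)]
    supercommutative[OF mult_degree[OF h(2,3)] alpha_degree[OF h(1)]]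
    supercommutative[OF alpha_degree[OF h(3)] mult_degree[OF h(1,2)]]
  show ?thesis
    by (simp only: triple_homogeneous[OF h(3,2)] triple_homogeneous[OF h(1,2)] c mult_linear)
      (cases i; cases j; cases k; simp add: signs algebra_simps)
qed

text \<open>Adding the rules for multiplication by \<open>x \<bullet> y\<close> and for
  \<open>inner_derivation\<close> gives sums in the outer arguments, namely
  \<open>triple x y u\<close> and \<open>triple x y w\<close>. In the middle one it gives the
  difference described by \<open>triple_rotate\<close>.\<close>

lemma triple_hom_jordan:
  assumes h: "x \<in> G i" "y \<in> G j" "u \<in> G k" "v \<in> G l" "w \<in> G m"
  shows "triple (\<alpha> (\<alpha> x)) (\<alpha> (\<alpha> y)) (triple u v w) - triple (triple x y u) (\<alpha> (\<alpha> v)) (\<alpha> (\<alpha> w)) =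
    scale (sign ((i + j) * (k + l)))
      (triple (\<alpha> (\<alpha> u)) (\<alpha> (\<alpha> v)) (triple x y w) - triple (\<alpha> (\<alpha> u)) (triple v x y) (\<alpha> (\<alpha> w)))"
proof -
  note a = alpha_degree
  \<comment> \<open>Moving \<alpha> inside the inner triple lets \<open>mult_triple\<close> apply to
    \<open>x \<bullet> y\<close> and the twisted vectors.\<close>
  have "triple (\<alpha> (\<alpha> x)) (\<alpha> (\<alpha> y)) (triple u v w) =
    \<alpha> (\<alpha> (x \<bullet> y)) \<bullet> triple (\<alpha> u) (\<alpha> v) (\<alpha> w) +
    inner_derivation i j (\<alpha> (\<alpha> x)) (\<alpha> (\<alpha> y)) (triple u v w)"
    unfolding triple_inner_derivation[OF h(1)[THEN a, THEN a] h(2)[THEN a, THEN a]]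
    by (simp only: alpha_mult alpha_triple)
  then show ?thesis
    by (simp only: mult_triple[OF mult_degree[OF h(1,2)] h(3-5)[THEN a]]
        inner_derivation_triple[OF h] triple_inner_derivation[OF h(1,2)] triple_rotate[OF h(1,2,4)]
        triple_linear)
      (cases i; cases j; cases k; cases l; simp add: signs algebra_simps)
qed

end

theorem theorem7p1:
  fixes scale :: "'k::field \<Rightarrow> 'a::ab_group_add \<Rightarrow> 'a"
    and G :: "bit \<Rightarrow> 'a set"
    and mult :: "'a \<Rightarrow> 'a \<Rightarrow> 'a"
    and \<alpha> :: "'a \<Rightarrow> 'a"
  assumes "CHAR('k) \<noteq> 2" and "CHAR('k) \<noteq> 3"
    and "multiplicative_hom_jordan_superalgebra scale G mult \<alpha>"
  shows "multiplicative_hom_jordan_supertriple_system scale G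
    (multiplicative_hom_superalgebra.triple scale G mult \<alpha>) (\<alpha> \<circ> \<alpha>)"
proof -
  interpret multiplicative_hom_jordan_superalgebra scale G mult \<alpha> by fact
  show ?thesis
  proof (intro multiplicative_hom_jordan_supertriple_system.intro
      multiplicative_hom_jordan_supertriple_system_axioms.intro superspace_axioms)
    show "trilinear_map scale triple" by (fact trilinear_triple)
    show "Vector_Spaces.linear scale scale (\<alpha> \<circ> \<alpha>)"
      by (rule linearI) (simp_all add: alpha_linear)
    show "even_map G (\<alpha> \<circ> \<alpha>)" unfolding even_map_def by (simp add: alpha_degree)
    show "(\<alpha> \<circ> \<alpha>) (triple x y z) = triple ((\<alpha> \<circ> \<alpha>) x) ((\<alpha> \<circ> \<alpha>) y) ((\<alpha> \<circ> \<alpha>) z)" for x y z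
      by (simp add: alpha_triple)
  \<comment> \<open>The degree rule, the symmetry and the five-variable identity remain.\<close>
  qed (unfold o_apply, (rule triple_degree triple_symmetric triple_hom_jordan; assumption)+)
qed

end
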